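(* Let $p\in\mathbb{C}[z_1,z_2]$ be a complex bivariate polynomial of total degree $d$ such that its initial form $\operatorname{in}(p)$ has no real roots in $\mathbb{P}^1$. If $d$ is odd, then the imaginary projection $\mathcal{I}(p)$ is equal to $\mathbb{R}^2$. As a consequence, the imaginary projection of a generic complex bivariate polynomial of odd total degree is $\mathbb{R}^2$.
   Context: For $p\in\mathbb{C}[z_1,\dots,z_n]$ with complex variety $\mathcal{V}(p)=\{\mathbf{z}\in\mathbb{C}^n : p(\mathbf{z})=0\}$, the imaginary projection is $\mathcal{I}(p)=\{(\operatorname{Im} z_1,\dots,\operatorname{Im} z_n) : \mathbf{z}\in\mathcal{V}(p)\}\subseteq\mathbb{R}^n$. The initial form $\operatorname{in}(p)$ is the sum of the terms of $p$ of maximal total degree. For $n=2$, a root of $\operatorname{in}(p)$ in $\mathbb{P}^1$ (complex projective line) is a point $(z_1:z_2)$ where $\operatorname{in}(p)$ vanishes; it is real if it lies in $\mathbb{P}^1_{\mathbb{R}}$. "Generic complex bivariate polynomial of odd total degree" means: for fixed odd $d$, all polynomials of total degree $d$ whose coefficient vectors, viewed in a real vector space by taking real and imaginary parts, lie outside some proper real algebraic subset. *)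

theory Defs
  imports "HOL-Analysis.Analysis" "HOL-Library.Poly_Mapping"
begin

section \<open>Multivariate polynomials\<close>

text \<open>
  A polynomial with variables indexed by \<open>'v\<close> maps each exponent vector \<open>'v \<Rightarrow>\<^sub>0 nat\<close> to its
  coefficient. Bivariate polynomials are the instance \<open>'v = 2\<close>.
\<close>

type_synonym ('v, 'a) mpoly = "('v \<Rightarrow>\<^sub>0 nat) \<Rightarrow>\<^sub>0 'a"

definition mpoly_eval :: "('v, 'a::comm_semiring_1) mpoly \<Rightarrow> ('v \<Rightarrow> 'a) \<Rightarrow> 'a" where
  "mpoly_eval p x =
     (\<Sum>m\<in>Poly_Mapping.keys p. Poly_Mapping.lookup p m *
        (\<Prod>i\<in>Poly_Mapping.keys m. x i ^ Poly_Mapping.lookup m i))"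

definition mpoly_vars :: "('v, 'a::zero) mpoly \<Rightarrow> 'v set" where
  "mpoly_vars p = (\<Union>m\<in>Poly_Mapping.keys p. Poly_Mapping.keys m)"

definition monom_degree :: "('v \<Rightarrow>\<^sub>0 nat) \<Rightarrow> nat" where
  "monom_degree m = (\<Sum>i\<in>Poly_Mapping.keys m. Poly_Mapping.lookup m i)"

text \<open>The zero polynomial gets total degree 0.\<close>

definition total_degree :: "('v, 'a::zero) mpoly \<Rightarrow> nat" where
  "total_degree p = Max (insert 0 (monom_degree ` Poly_Mapping.keys p))"

definition initial_form :: "('v, 'a::comm_monoid_add) mpoly \<Rightarrow> ('v, 'a) mpoly" where
  "initial_form p =
     (\<Sum>m\<in>{m \<in> Poly_Mapping.keys p. monom_degree m = total_degree p}.
        Poly_Mapping.single m (Poly_Mapping.lookup p m))"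

section \<open>Imaginary projections\<close>

definition variety :: "('n::finite, complex) mpoly \<Rightarrow> (complex ^ 'n) set" where
  "variety p = {z. mpoly_eval p (($) z) = 0}"

definition imaginary_projection :: "('n::finite, complex) mpoly \<Rightarrow> (real ^ 'n) set" where
  "imaginary_projection p = (\<lambda>z. \<chi> i. Im (z $ i)) ` variety p"

section \<open>Projective space\<close>

text \<open>
  The point with homogeneous coordinates \<open>z\<close> is the set of all its nonzero multiples, so the
  complex projective line consists of the sets \<open>proj_point z\<close> with nonzero \<open>z :: complex ^ 2\<close>.
\<close>

definition proj_point :: "complex ^ 'n \<Rightarrow> (complex ^ 'n) set" where
  "proj_point z = {c *s z | c. c \<noteq> 0}"

definition proj_space :: "(complex ^ 'n) set set" where
  "proj_space = {proj_point z | z. z \<noteq> 0}"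

definition real_proj_space :: "(complex ^ 'n) set set" where
  "real_proj_space = {proj_point (\<chi> i. complex_of_real (x $ i)) | x. x \<noteq> 0}"

definition proj_roots :: "('n::finite, complex) mpoly \<Rightarrow> (complex ^ 'n) set set" where
  "proj_roots f = {P \<in> proj_space. \<forall>z\<in>P. mpoly_eval f (($) z) = 0}"

section \<open>Genericity\<close>

text \<open>
  For a finite set \<open>I\<close> of coordinates, the affine space \<open>I \<rightarrow>\<^sub>E UNIV\<close> stands for real
  \<open>card I\<close>-space. Elements of it take an arbitrary dummy value outside \<open>I\<close>, hence the restriction
  on the variables of the defining polynomials.
\<close>

definition real_algebraic_subset :: "'i set \<Rightarrow> ('i \<Rightarrow> real) set \<Rightarrow> bool" where
  "real_algebraic_subset I S \<longleftrightarrow>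
     (\<exists>F :: ('i, real) mpoly set. finite F \<and> (\<forall>q\<in>F. mpoly_vars q \<subseteq> I) \<and>
        S = {x \<in> I \<rightarrow>\<^sub>E UNIV. \<forall>q\<in>F. mpoly_eval q x = 0})"

text \<open>
  A complex polynomial of total degree at most \<open>d\<close> has two real coordinates per exponent
  vector \<open>m\<close>: \<open>Inl m\<close> for the real and \<open>Inr m\<close> for the imaginary part of the coefficient.
\<close>

definition coeff_coords :: "nat \<Rightarrow> (('n \<Rightarrow>\<^sub>0 nat) + ('n \<Rightarrow>\<^sub>0 nat)) set" where
  "coeff_coords d = {m. monom_degree m \<le> d} <+> {m. monom_degree m \<le> d}"

definition coeff_vector ::
    "nat \<Rightarrow> ('n, complex) mpoly \<Rightarrow> (('n \<Rightarrow>\<^sub>0 nat) + ('n \<Rightarrow>\<^sub>0 nat)) \<Rightarrow> real" where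
  "coeff_vector d p =
     restrict (case_sum (\<lambda>m. Re (Poly_Mapping.lookup p m)) (\<lambda>m. Im (Poly_Mapping.lookup p m)))
       (coeff_coords d)"

definition holds_generically :: "nat \<Rightarrow> (('n::finite, complex) mpoly \<Rightarrow> bool) \<Rightarrow> bool" where
  "holds_generically d Q \<longleftrightarrow>
     (\<exists>S. real_algebraic_subset (coeff_coords d) S \<and> S \<noteq> (coeff_coords d \<rightarrow>\<^sub>E UNIV) \<and>
        (\<forall>p. total_degree p = d \<and> coeff_vector d p \<notin> S \<longrightarrow> Q p))"

end

(* Fix y and look for a real x with p (x + i y) = 0. On a large circle the map q x = p (x + i y) is
   a small perturbation of in(p), which is odd and has no zeros there, so q x / q (-x) is close
   to -1. If q had no zero in the disk it would be exp g with g continuous, and by the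
   intermediate value theorem the odd function x |-> Im (g x - g (-x)) would vanish somewhere on
   the circle, making q x / q (-x) positive there.

   For genericity, a real root of in(p) is a common root of the two real binary forms Re in(p) and
   Im in(p), hence a zero of their resultant. The resultant is a polynomial in the coordinates of
   the coefficients and takes the value 1 at z_1^d + i z_2^d. *)

theory Submission
  imports Defs "Jordan_Normal_Form.Determinant"
begin

no_notation vec_index (infixl "$" 100)

section \<open>Odd maps of the circle\<close>

text \<open>The hypothesis puts \<open>q x / q (- x)\<close> in the open left half-plane. An odd map
  without zeros on the circle satisfies it, and so does every small continuous perturbation of such
  a map.\<close>

lemma zero_in_disk:
  fixes q :: "real^2 \<Rightarrow> complex"
  assumes cont: "continuous_on (cball 0 1) q"
    and neg: "\<And>x. x \<in> sphere 0 1 \<Longrightarrow> Re (q x * cnj (q (- x))) < 0"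
  obtains x where "q x = 0"
proof (rule ccontr)
  assume "\<not> thesis"
  then have nz: "\<And>x. q x \<noteq> 0"
    using that by blast
  obtain g where g: "continuous_on (cball 0 1) g" "\<And>x. x \<in> cball 0 1 \<Longrightarrow> q x = exp (g x)"
    using continuous_logarithm_on_cball[OF cont nz] by metis
  define h where "h x = Im (g x - g (- x))" for x
  have "continuous_on (sphere 0 1) h"
    unfolding h_def
    by (intro continuous_intros continuous_on_compose2[OF g(1)]) auto
  moreover have "connected (sphere (0 :: real^2) 1)"
    by (intro connected_sphere) simp
  ultimately have conn: "connected (h ` sphere 0 1)"
    by (rule connected_continuous_image)
  obtain e :: "real^2" where e: "e \<in> sphere 0 1"
    using vector_choose_size[of 1, where 'a = "real^2"] by auto
  \<comment> \<open>\<open>h\<close> is odd, so its connected image contains both \<open>h e\<close>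
    and \<open>- h e\<close>, hence also 0.\<close>
  have "h (- e) \<in> h ` sphere 0 1"
    using e by (intro imageI) simp
  moreover have "h (- e) = - h e"
    by (simp add: h_def)
  ultimately have "- h e \<in> h ` sphere 0 1" "h e \<in> h ` sphere 0 1"
    using e by simp_all
  then have "0 \<in> h ` sphere 0 1"
    using connectedD_interval[OF conn, of "- h e" "h e" 0] connectedD_interval[OF conn, of "h e" "- h e" 0]
    by (cases "h e \<ge> 0") auto
  then obtain x where x: "x \<in> sphere 0 1" "Im (g x) = Im (g (- x))"
    by (auto simp: h_def)
  \<comment> \<open>Equal imaginary parts of \<open>g x\<close> and \<open>g (- x)\<close> make this
    exponent real, so the product is positive.\<close>
  have "q x * cnj (q (- x)) = exp (g x + cnj (g (- x)))"
    using x(1) by (simp add: g(2) exp_add exp_cnj)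
  also have "Re \<dots> = exp (Re (g x) + Re (g (- x)))"
    using x(2) by (simp add: Re_exp)
  finally show False
    using neg[OF x(1)] by simp
qed

section \<open>Evaluation of polynomials\<close>

definition monom_eval :: "('v \<Rightarrow>\<^sub>0 nat) \<Rightarrow> ('v \<Rightarrow> 'a::comm_semiring_1) \<Rightarrow> 'a" where
  "monom_eval m x = (\<Prod>i\<in>Poly_Mapping.keys m. x i ^ Poly_Mapping.lookup m i)"

lemma monom_eval_superset:
  assumes "finite A" "Poly_Mapping.keys m \<subseteq> A"
  shows "monom_eval m x = (\<Prod>i\<in>A. x i ^ Poly_Mapping.lookup m i)"
  unfolding monom_eval_def
  by (rule prod.mono_neutral_left) (use assms in \<open>auto simp: in_keys_iff\<close>)

lemma monom_degree_superset:
  assumes "finite A" "Poly_Mapping.keys m \<subseteq> A"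
  shows "monom_degree m = (\<Sum>i\<in>A. Poly_Mapping.lookup m i)"
  unfolding monom_degree_def
  by (rule sum.mono_neutral_left) (use assms in \<open>auto simp: in_keys_iff\<close>)

lemma monom_eval_add: "monom_eval (m + n) x = monom_eval m x * monom_eval n x"
proof -
  let ?A = "Poly_Mapping.keys m \<union> Poly_Mapping.keys n"
  have "monom_eval (m + n) x = (\<Prod>i\<in>?A. x i ^ Poly_Mapping.lookup (m + n) i)"
    by (rule monom_eval_superset) (use keys_add[of m n] in auto)
  also have "\<dots> = (\<Prod>i\<in>?A. x i ^ Poly_Mapping.lookup m i) * (\<Prod>i\<in>?A. x i ^ Poly_Mapping.lookup n i)"
    by (simp add: lookup_add power_add prod.distrib)
  also have "\<dots> = monom_eval m x * monom_eval n x"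
    by (simp add: monom_eval_superset[of ?A])
  finally show ?thesis .
qed

lemma monom_eval_scale: "monom_eval m (\<lambda>i. c * x i) = c ^ monom_degree m * monom_eval m x"
  by (simp add: monom_eval_def monom_degree_def power_mult_distrib prod.distrib power_sum)

lemma mpoly_eval_monom_eval:
  "mpoly_eval p x = (\<Sum>m\<in>Poly_Mapping.keys p. Poly_Mapping.lookup p m * monom_eval m x)"
  by (simp add: mpoly_eval_def monom_eval_def)

lemma mpoly_eval_superset:
  assumes "finite A" "Poly_Mapping.keys p \<subseteq> A"
  shows "mpoly_eval p x = (\<Sum>m\<in>A. Poly_Mapping.lookup p m * monom_eval m x)"
  unfolding mpoly_eval_monom_eval
  by (rule sum.mono_neutral_left) (use assms in \<open>auto simp: in_keys_iff\<close>)

lemma mpoly_eval_add: "mpoly_eval (p + q) x = mpoly_eval p x + mpoly_eval q x"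
proof -
  let ?A = "Poly_Mapping.keys p \<union> Poly_Mapping.keys q"
  have "mpoly_eval (p + q) x = (\<Sum>m\<in>?A. Poly_Mapping.lookup (p + q) m * monom_eval m x)"
    by (rule mpoly_eval_superset) (use keys_add[of p q] in auto)
  also have "\<dots> = mpoly_eval p x + mpoly_eval q x"
    by (simp add: mpoly_eval_superset[of ?A] lookup_add distrib_right sum.distrib)
  finally show ?thesis .
qed

lemma mpoly_eval_0 [simp]: "mpoly_eval 0 x = 0"
  by (simp add: mpoly_eval_def)

lemma mpoly_eval_sum: "mpoly_eval (sum p A) x = (\<Sum>a\<in>A. mpoly_eval (p a) x)"
  by (induction A rule: infinite_finite_induct) (auto simp: mpoly_eval_add)

lemma mpoly_eval_single: "mpoly_eval (Poly_Mapping.single m c) x = c * monom_eval m x"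
  by (simp add: mpoly_eval_monom_eval)

lemma mpoly_sum_singles:
  "p = (\<Sum>m\<in>Poly_Mapping.keys p. Poly_Mapping.single m (Poly_Mapping.lookup p m))"
  by (rule poly_mapping_eqI) (auto simp: lookup_sum lookup_single when_def in_keys_iff)

lemma mpoly_eval_mult: "mpoly_eval (p * q) x = mpoly_eval p x * mpoly_eval q x"
proof -
  have "p * q = (\<Sum>m\<in>Poly_Mapping.keys p. \<Sum>n\<in>Poly_Mapping.keys q.
      Poly_Mapping.single (m + n) (Poly_Mapping.lookup p m * Poly_Mapping.lookup q n))"
    by (subst mpoly_sum_singles[of p], subst mpoly_sum_singles[of q])
      (simp add: sum_product mult_single)
  also have "mpoly_eval \<dots> x = mpoly_eval p x * mpoly_eval q x"
    by (simp add: mpoly_eval_sum mpoly_eval_single mpoly_eval_monom_eval[of p]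
        mpoly_eval_monom_eval[of q] sum_product monom_eval_add mult_ac)
  finally show ?thesis .
qed

lemma monom_degree_le_total_degree:
  "m \<in> Poly_Mapping.keys p \<Longrightarrow> monom_degree m \<le> total_degree p"
  by (simp add: total_degree_def)

lemma lookup_initial_form:
  "Poly_Mapping.lookup (initial_form p) m =
     (if monom_degree m = total_degree p then Poly_Mapping.lookup p m else 0)"
  by (auto simp: initial_form_def lookup_sum lookup_single when_def in_keys_iff)

lemma mpoly_eval_initial_form:
  "mpoly_eval (initial_form p) x =
     (\<Sum>m\<in>Poly_Mapping.keys p. if monom_degree m = total_degree p
        then Poly_Mapping.lookup p m * monom_eval m x else 0)"
  by (subst mpoly_eval_superset[of "Poly_Mapping.keys p"])
    (auto simp: lookup_initial_form in_keys_iff intro!: sum.cong split: if_splits)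

text \<open>All monomials of the initial form have the same degree. The case \<open>c = -1\<close>
  gives oddness in odd degree; general \<open>c\<close> makes vanishing a property of the projective
  point.\<close>

lemma mpoly_eval_initial_form_scale:
  "mpoly_eval (initial_form p) (\<lambda>i. c * x i) =
     c ^ total_degree p * mpoly_eval (initial_form p) x"
  by (auto simp: mpoly_eval_initial_form monom_eval_scale sum_distrib_left mult_ac intro!: sum.cong)

section \<open>Polynomials of odd degree\<close>

text \<open>
  For \<open>t \<noteq> 0\<close> this is \<open>t ^ d * p (x / t + \<i> y)\<close>, where \<open>d\<close> is the total degree; at \<open>t = 0\<close> it
  degenerates continuously to the initial form at \<open>x\<close>.
\<close>

definition shear :: "('n::finite, complex) mpoly \<Rightarrow> real^'n \<Rightarrow> real \<Rightarrow> real^'n \<Rightarrow> complex" where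
  "shear p y t x = (\<Sum>m\<in>Poly_Mapping.keys p. Poly_Mapping.lookup p m *
     of_real t ^ (total_degree p - monom_degree m) *
     monom_eval m (\<lambda>i. of_real (x $ i) + of_real t * (\<i> * of_real (y $ i))))"

text \<open>The exponent \<open>total_degree p - monom_degree m\<close> never truncates, so at
  \<open>t = 0\<close> its power of \<open>t\<close> is 1 on terms of top degree and 0 on all
  others.\<close>

lemma shear_0: "shear p y 0 x = mpoly_eval (initial_form p) (\<lambda>i. of_real (x $ i))"
  unfolding shear_def mpoly_eval_initial_form
  by (rule sum.cong) (auto simp: power_0_left dest: monom_degree_le_total_degree)

text \<open>Pulling \<open>t\<close> out of every variable yields \<open>t ^ monom_degree m\<close>,
  which completes the explicit power to \<open>t ^ total_degree p\<close>.\<close>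

lemma shear_nonzero:
  assumes "t \<noteq> 0"
  shows "shear p y t x =
    of_real t ^ total_degree p * mpoly_eval p (\<lambda>i. of_real (x $ i / t) + \<i> * of_real (y $ i))"
proof -
  let ?z = "\<lambda>i. of_real (x $ i / t) + \<i> * of_real (y $ i)"
  have eq: "(\<lambda>i. of_real (x $ i) + of_real t * (\<i> * of_real (y $ i))) = (\<lambda>i. of_real t * ?z i)"
    using assms by (auto simp: field_simps)
  have "of_real t ^ (total_degree p - monom_degree m) * monom_eval m (\<lambda>i. of_real t * ?z i) =
      of_real t ^ total_degree p * monom_eval m ?z" if "m \<in> Poly_Mapping.keys p" for m
    unfolding monom_eval_scale mult.assoc[symmetric] power_add[symmetric]
    using monom_degree_le_total_degree[OF that] by simp
  then show ?thesis
    unfolding shear_def eq mpoly_eval_monom_eval sum_distrib_left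
    by (intro sum.cong) (auto simp: mult_ac)
qed

text \<open>Joint continuity in \<open>t\<close> and \<open>x\<close>, as the tube lemma requires an
  open set of pairs.\<close>

lemma continuous_on_shear [continuous_intros]:
  assumes "continuous_on A f" "continuous_on A g"
  shows "continuous_on A (\<lambda>a. shear p y (f a) (g a))"
  unfolding shear_def monom_eval_def using assms by (intro continuous_intros)

lemma imaginary_projection_odd_degree:
  fixes p :: "(2, complex) mpoly"
  assumes odd: "odd (total_degree p)"
    and nz: "\<And>x :: real^2. x \<noteq> 0 \<Longrightarrow> mpoly_eval (initial_form p) (\<lambda>i. of_real (x $ i)) \<noteq> 0"
  shows "imaginary_projection p = UNIV"
proof -
  have "y \<in> imaginary_projection p" for y
  proof -
    define \<phi> where "\<phi> t x = Re (shear p y t x * cnj (shear p y t (- x)))" for t x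
    define W where "W = {tx. \<phi> (fst tx) (snd tx) < 0}"
    have W: "open W"
      unfolding W_def \<phi>_def by (intro open_Collect_less continuous_intros)
    have "{0} \<times> sphere 0 1 \<subseteq> W"
    proof clarify
      fix x :: "real^2" assume "x \<in> sphere 0 1"
      then have "x \<noteq> 0"
        by auto
      have "shear p y 0 (- x) = - shear p y 0 x"
        using mpoly_eval_initial_form_scale[of p "-1" "\<lambda>i. of_real (x $ i)"] odd
        by (simp add: shear_0)
      then have "\<phi> 0 x = - (cmod (shear p y 0 x))\<^sup>2"
        by (simp add: \<phi>_def cmod_power2) (simp add: power2_eq_square)
      then show "(0, x) \<in> W"
        using nz[OF \<open>x \<noteq> 0\<close>] by (simp add: W_def shear_0)
    qed
    \<comment> \<open>Compactness of the circle gives a single \<open>t > 0\<close> that works for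
      all \<open>x\<close> on it. A small \<open>t\<close> corresponds to the large circle of radius
      \<open>1 / t\<close>.\<close>
    from Elementary_Topology.tube_lemma[OF compact_sphere W this]
    obtain X where X: "0 \<in> X" "open X" "X \<times> sphere 0 1 \<subseteq> W"
      by (elim exE conjE)
    then obtain e where e: "e > 0" "ball 0 e \<subseteq> X"
      using open_contains_ball by metis
    define t where "t = e / 2"
    have t: "t > 0" "t \<in> X"
      using e by (auto simp: t_def subset_iff)
    obtain x where "shear p y t x = 0"
    proof (rule zero_in_disk)
      show "continuous_on (cball 0 1) (shear p y t)"
        by (intro continuous_intros)
      fix x :: "real^2" assume "x \<in> sphere 0 1"
      then have "(t, x) \<in> W"
        using X(3) t(2) by blast
      then show "Re (shear p y t x * cnj (shear p y t (- x))) < 0"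
        by (simp add: W_def \<phi>_def)
    qed
    then have "mpoly_eval p (\<lambda>i. of_real (x $ i / t) + \<i> * of_real (y $ i)) = 0"
      using t(1) by (simp add: shear_nonzero)
    moreover have "vec_nth (\<chi> i. of_real (x $ i / t) + \<i> * of_real (y $ i)) =
        (\<lambda>i. of_real (x $ i / t) + \<i> * of_real (y $ i))"
      by (rule ext) simp
    ultimately have "(\<chi> i. of_real (x $ i / t) + \<i> * of_real (y $ i)) \<in> variety p"
      unfolding variety_def by (simp only: mem_Collect_eq)
    then show ?thesis
      unfolding imaginary_projection_def by (rule rev_image_eqI) (simp add: Finite_Cartesian_Product.vec_eq_iff)
  qed
  then show ?thesis
    by blast
qed

text \<open>By homogeneity a zero at one real representative is a zero at all its complex multiples,
  hence a real projective root.\<close>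

lemma initial_form_nonzero:
  assumes "proj_roots (initial_form p) \<inter> real_proj_space = {}" and "x \<noteq> 0"
  shows "mpoly_eval (initial_form p) (\<lambda>i. of_real (x $ i)) \<noteq> 0"
proof
  assume eq: "mpoly_eval (initial_form p) (\<lambda>i. of_real (x $ i)) = 0"
  let ?z = "(\<chi> i. complex_of_real (x $ i))"
  have "?z \<noteq> 0"
    using assms(2) by (auto simp: Finite_Cartesian_Product.vec_eq_iff)
  moreover have "mpoly_eval (initial_form p) (vec_nth w) = 0" if w: "w \<in> proj_point ?z" for w
  proof -
    obtain c where "w = c *s ?z"
      using w unfolding proj_point_def by blast
    then have "vec_nth w = (\<lambda>i. c * of_real (x $ i))"
      by (intro ext) simp
    then show ?thesis
      using eq mpoly_eval_initial_form_scale[of p c "\<lambda>i. of_real (x $ i)"] by simp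
  qed
  ultimately have "proj_point ?z \<in> proj_roots (initial_form p) \<inter> real_proj_space"
    using assms(2) by (auto simp: proj_roots_def real_proj_space_def proj_space_def)
  then show False
    using assms(1) by blast
qed

section \<open>Polynomial functions\<close>

text \<open>Real algebraic subsets are cut out by formal polynomials. This predicate supplies one
  for a given function through closure rules, while \<open>I\<close> bounds its variables.\<close>

definition poly_fun :: "'i set \<Rightarrow> (('i \<Rightarrow> 'a::comm_semiring_1) \<Rightarrow> 'a) \<Rightarrow> bool" where
  "poly_fun I f \<longleftrightarrow> (\<exists>q. mpoly_vars q \<subseteq> I \<and> (\<forall>x. mpoly_eval q x = f x))"

lemma poly_fun_const: "poly_fun I (\<lambda>x. c)"
  unfolding poly_fun_def
  by (rule exI[of _ "Poly_Mapping.single 0 c"])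
    (auto simp: mpoly_vars_def mpoly_eval_single monom_eval_def)

lemma poly_fun_var: "i \<in> I \<Longrightarrow> poly_fun I (\<lambda>x. x i)"
  unfolding poly_fun_def
  by (rule exI[of _ "Poly_Mapping.single (Poly_Mapping.single i 1) 1"])
    (auto simp: mpoly_vars_def mpoly_eval_single monom_eval_def)

lemma poly_fun_add: "poly_fun I f \<Longrightarrow> poly_fun I g \<Longrightarrow> poly_fun I (\<lambda>x. f x + g x)"
  unfolding poly_fun_def
proof (elim exE conjE)
  fix p q assume "mpoly_vars p \<subseteq> I" "\<forall>x. mpoly_eval p x = f x"
    "mpoly_vars q \<subseteq> I" "\<forall>x. mpoly_eval q x = g x"
  then show "\<exists>q. mpoly_vars q \<subseteq> I \<and> (\<forall>x. mpoly_eval q x = f x + g x)"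
    using keys_add[of p q]
    by (intro exI[of _ "p + q"]) (auto simp: mpoly_vars_def mpoly_eval_add, blast)
qed

lemma poly_fun_mult: "poly_fun I f \<Longrightarrow> poly_fun I g \<Longrightarrow> poly_fun I (\<lambda>x. f x * g x)"
  unfolding poly_fun_def
proof (elim exE conjE)
  fix p q assume *: "mpoly_vars p \<subseteq> I" "\<forall>x. mpoly_eval p x = f x"
    "mpoly_vars q \<subseteq> I" "\<forall>x. mpoly_eval q x = g x"
  have "mpoly_vars (p * q) \<subseteq> mpoly_vars p \<union> mpoly_vars q"
    using keys_mult[of p q] keys_add by (fastforce simp: mpoly_vars_def)
  with * show "\<exists>q. mpoly_vars q \<subseteq> I \<and> (\<forall>x. mpoly_eval q x = f x * g x)"
    by (intro exI[of _ "p * q"]) (auto simp: mpoly_eval_mult)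
qed

lemma poly_fun_sum: "(\<And>a. a \<in> A \<Longrightarrow> poly_fun I (f a)) \<Longrightarrow> poly_fun I (\<lambda>x. \<Sum>a\<in>A. f a x)"
  by (induction A rule: infinite_finite_induct) (auto intro: poly_fun_const poly_fun_add)

lemma poly_fun_prod: "(\<And>a. a \<in> A \<Longrightarrow> poly_fun I (f a)) \<Longrightarrow> poly_fun I (\<lambda>x. \<Prod>a\<in>A. f a x)"
  by (induction A rule: infinite_finite_induct) (auto intro: poly_fun_const poly_fun_mult)

text \<open>The Leibniz formula writes the determinant as a sum of signed products of
  entries.\<close>

lemma poly_fun_det:
  assumes "\<And>i j. i < n \<Longrightarrow> j < n \<Longrightarrow> poly_fun I (\<lambda>x. A x i j)"
  shows "poly_fun I (\<lambda>x. Determinant.det (mat n n (\<lambda>(i, j). A x i j)))"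
proof -
  have "(\<Prod>i = 0..<n. mat n n (\<lambda>(i, j). A x i j) $$ (i, \<pi> i)) = (\<Prod>i = 0..<n. A x i (\<pi> i))"
    if "\<pi> permutes {0..<n}" for \<pi> x
    using permutes_in_image[OF that] by (intro prod.cong) auto
  then have eq: "Determinant.det (mat n n (\<lambda>(i, j). A x i j)) =
      (\<Sum>\<pi> | \<pi> permutes {0..<n}. signof \<pi> * (\<Prod>i = 0..<n. A x i (\<pi> i)))" for x
    by (subst det_def'[of _ n]) (auto intro!: sum.cong)
  show ?thesis
    unfolding eq using permutes_in_image
    by (intro poly_fun_sum poly_fun_mult poly_fun_const poly_fun_prod assms) fastforce+
qed

section \<open>The resultant of two binary forms\<close>

text \<open>
  Here \<open>g i\<close> is the coefficient of \<open>a ^ (d - i) * b ^ i\<close>, and likewise for \<open>h\<close>. Row \<open>s < d\<close> lists the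
  coefficients of \<open>a ^ (d - 1 - s) * b ^ s * g\<close>, row \<open>d + s\<close> those of \<open>a ^ (d - 1 - s) * b ^ s * h\<close>.
\<close>

definition sylvester :: "nat \<Rightarrow> (nat \<Rightarrow> 'a) \<Rightarrow> (nat \<Rightarrow> 'a) \<Rightarrow> nat \<Rightarrow> nat \<Rightarrow> 'a::comm_ring_1" where
  "sylvester d g h k j =
     (if k < d then if k \<le> j \<and> j \<le> k + d then g (j - k) else 0
      else if k - d \<le> j \<and> j \<le> k then h (j - (k - d)) else 0)"

text \<open>For fixed \<open>k\<close> and \<open>j\<close> the entry is either 0 or a single
  coefficient of index at most \<open>d\<close>, and this choice does not depend on
  \<open>x\<close>.\<close>

lemma poly_fun_sylvester:
  assumes "\<And>i. i \<le> d \<Longrightarrow> poly_fun I (\<lambda>x. g x i)" "\<And>i. i \<le> d \<Longrightarrow> poly_fun I (\<lambda>x. h x i)"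
  shows "poly_fun I (\<lambda>x. sylvester d (g x) (h x) k j)"
  by (cases "k < d"; cases "k \<le> j"; cases "j \<le> k + d"; cases "k - d \<le> j"; cases "j \<le> k")
    (simp_all add: sylvester_def poly_fun_const assms)

text \<open>Pairing a row with the monomials of degree \<open>2*d - 1\<close> at
  \<open>(a, b)\<close> evaluates the shifted form. The lemma serves both halves of the
  matrix.\<close>

lemma sylvester_row:
  fixes g :: "nat \<Rightarrow> 'a::comm_ring_1"
  assumes "s < d"
  shows "(\<Sum>j = 0..<2*d. (if s \<le> j \<and> j \<le> s + d then g (j - s) else 0) * (a ^ (2*d - 1 - j) * b ^ j)) =
    a ^ (d - 1 - s) * b ^ s * (\<Sum>i\<le>d. g i * a ^ (d - i) * b ^ i)"
proof -
  have "(\<Sum>j = 0..<2*d. (if s \<le> j \<and> j \<le> s + d then g (j - s) else 0) * (a ^ (2*d - 1 - j) * b ^ j)) =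
      (\<Sum>j\<in>{s..s + d}. g (j - s) * (a ^ (2*d - 1 - j) * b ^ j))"
    using assms by (intro sum.mono_neutral_cong_right) auto
  also have "\<dots> = (\<Sum>i\<le>d. g i * (a ^ (2*d - 1 - (i + s)) * b ^ (i + s)))"
    by (rule sum.reindex_bij_witness[of _ "\<lambda>i. i + s" "\<lambda>j. j - s"]) auto
  also have "\<dots> = (\<Sum>i\<le>d. a ^ (d - 1 - s) * b ^ s * (g i * a ^ (d - i) * b ^ i))"
  proof (rule sum.cong)
    fix i assume "i \<in> {..d}"
    \<comment> \<open>No subtraction truncates here, because \<open>s < d\<close> and
      \<open>i \<le> d\<close>.\<close>
    then have "2*d - 1 - (i + s) = (d - 1 - s) + (d - i)"
      using assms by simp
    then show "g i * (a ^ (2*d - 1 - (i + s)) * b ^ (i + s)) =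
        a ^ (d - 1 - s) * b ^ s * (g i * a ^ (d - i) * b ^ i)"
      by (simp only: power_add mult_ac)
  qed simp
  finally show ?thesis
    by (simp add: sum_distrib_left)
qed

text \<open>At a common root the vector of all monomials of degree \<open>2*d - 1\<close> lies in
  the kernel of the matrix.\<close>

lemma det_sylvester_common_root:
  fixes a b :: "'a::idom"
  assumes "d > 0" "a \<noteq> 0 \<or> b \<noteq> 0"
    and g: "(\<Sum>i\<le>d. g i * a ^ (d - i) * b ^ i) = 0"
    and h: "(\<Sum>i\<le>d. h i * a ^ (d - i) * b ^ i) = 0"
  shows "Determinant.det (mat (2*d) (2*d) (\<lambda>(k, j). sylvester d g h k j)) = 0"
proof -
  let ?A = "mat (2*d) (2*d) (\<lambda>(k, j). sylvester d g h k j)"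
  define v where "v = Matrix.vec (2*d) (\<lambda>j. a ^ (2*d - 1 - j) * b ^ j)"
  have "?A *\<^sub>v v = 0\<^sub>v (2*d)"
  proof (rule eq_vecI)
    fix k assume k: "k < dim_vec (0\<^sub>v (2*d) :: 'a Matrix.vec)"
    then have "vec_index (?A *\<^sub>v v) k =
        (\<Sum>j = 0..<2*d. sylvester d g h k j * (a ^ (2*d - 1 - j) * b ^ j))"
      by (simp add: v_def scalar_prod_def)
    also have "\<dots> = 0"
    proof (cases "k < d")
      case True
      then show ?thesis
        using sylvester_row[of k d g a b] g by (simp add: sylvester_def)
    next
      case False
      \<comment> \<open>In the lower half \<open>s = k - d\<close>, so the last column
        \<open>s + d\<close> of the band is \<open>k\<close>.\<close>
      then have "k - d < d" "k = k - d + d"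
        using k by auto
      then show ?thesis
        using sylvester_row[of "k - d" d h a b] h False by (simp add: sylvester_def)
    qed
    finally show "vec_index (?A *\<^sub>v v) k = vec_index (0\<^sub>v (2*d)) k"
      using k by simp
  qed simp
  \<comment> \<open>The first and last entries of \<open>v\<close> are powers of \<open>a\<close>
    and of \<open>b\<close>, and one of these is nonzero in a domain.\<close>
  moreover have "v \<noteq> 0\<^sub>v (2*d)"
  proof
    assume "v = 0\<^sub>v (2*d)"
    then have "vec_index v 0 = 0" "vec_index v (2*d - 1) = 0"
      using assms(1) by auto
    then show False
      using assms(1,2) by (auto simp: v_def power_0_left split: if_splits)
  qed
  moreover have "v \<in> carrier_vec (2*d)" "?A \<in> carrier_mat (2*d) (2*d)"
    by (auto simp: v_def)
  ultimately show ?thesis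
    using det_0_iff_vec_prod_zero by blast
qed

text \<open>For the forms \<open>a ^ d\<close> and \<open>b ^ d\<close> the Sylvester matrix is the
  identity. This shows that the resultant does not vanish identically.\<close>

lemma det_sylvester_powers:
  "Determinant.det (mat (2*d) (2*d) (\<lambda>(k, j).
     sylvester d (\<lambda>i. if i = 0 then 1 else 0) (\<lambda>i. if i = d then 1 else 0) k j)) = 1"
  (is "Determinant.det ?A = 1")
proof -
  have "?A = 1\<^sub>m (2*d)"
    by (rule eq_matI) (auto simp: sylvester_def)
  then show ?thesis
    by simp
qed

section \<open>Generic polynomials\<close>

text \<open>For \<open>i \<le> d\<close> this is the exponent vector of
  \<open>z_1^(d-i) z_2^i\<close>. The index type \<open>2\<close> has the elements 1 and 2, where 2
  equals 0.\<close>

definition bimonom :: "nat \<Rightarrow> nat \<Rightarrow> 2 \<Rightarrow>\<^sub>0 nat" where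
  "bimonom d i = Poly_Mapping.single 1 (d - i) + Poly_Mapping.single 2 i"

lemma lookup_bimonom:
  "Poly_Mapping.lookup (bimonom d i) 1 = d - i" "Poly_Mapping.lookup (bimonom d i) 2 = i"
  by (simp_all add: bimonom_def lookup_add lookup_single)

lemma inj_on_bimonom: "inj_on (bimonom d) A"
  by (metis inj_onI lookup_bimonom(2))

lemma monom_degree_2:
  "monom_degree m = Poly_Mapping.lookup m (1 :: 2) + Poly_Mapping.lookup m 2"
  by (subst monom_degree_superset[of UNIV]) (auto simp: sum_2)

lemma monom_degree_bimonom: "i \<le> d \<Longrightarrow> monom_degree (bimonom d i) = d"
  by (simp add: monom_degree_2 lookup_bimonom)

lemma monom_eval_bimonom: "monom_eval (bimonom d i) x = x 1 ^ (d - i) * x 2 ^ i"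
  by (subst monom_eval_superset[of UNIV], simp, simp, simp add: UNIV_2 lookup_bimonom)

lemma bimonom_eqI:
  assumes "monom_degree m = d"
  shows "m = bimonom d (Poly_Mapping.lookup m 2)"
proof (rule poly_mapping_eqI)
  show "Poly_Mapping.lookup m k = Poly_Mapping.lookup (bimonom d (Poly_Mapping.lookup m 2)) k" for k
    using assms exhaust_2[of k] by (auto simp: monom_degree_2 lookup_bimonom)
qed

lemma mpoly_eval_initial_form_2:
  fixes p :: "(2, 'a::comm_semiring_1) mpoly"
  assumes "total_degree p = d"
  shows "mpoly_eval (initial_form p) x =
    (\<Sum>i\<le>d. Poly_Mapping.lookup p (bimonom d i) * x 1 ^ (d - i) * x 2 ^ i)"
proof -
  have "Poly_Mapping.keys (initial_form p) \<subseteq> bimonom d ` {..d}"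
  proof
    fix m assume "m \<in> Poly_Mapping.keys (initial_form p)"
    then have "monom_degree m = d"
      using assms by (auto simp: in_keys_iff lookup_initial_form split: if_splits)
    then show "m \<in> bimonom d ` {..d}"
      using bimonom_eqI[of m d] by (intro image_eqI) (auto simp: monom_degree_2)
  qed
  then show ?thesis
    by (subst mpoly_eval_superset[of "bimonom d ` {..d}"])
      (auto simp: sum.reindex[OF inj_on_bimonom] lookup_initial_form monom_degree_bimonom
        monom_eval_bimonom assms mult.assoc)
qed

text \<open>The exceptional set is the zero set of the resultant \<open>R\<close> of the two real
  forms given by the real and imaginary parts of the top coefficients.\<close>

lemma generic_initial_form_nonzero:
  assumes "d > 0"
  shows "holds_generically d (\<lambda>p :: (2, complex) mpoly. \<forall>x :: real^2. x \<noteq> 0 \<longrightarrow>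
    mpoly_eval (initial_form p) (\<lambda>i. of_real (x $ i)) \<noteq> 0)"
proof -
  define R :: "((2 \<Rightarrow>\<^sub>0 nat) + (2 \<Rightarrow>\<^sub>0 nat) \<Rightarrow> real) \<Rightarrow> real" where
    "R x = Determinant.det (mat (2*d) (2*d) (\<lambda>(k, j).
       sylvester d (\<lambda>i. x (Inl (bimonom d i))) (\<lambda>i. x (Inr (bimonom d i))) k j))" for x
  define I :: "((2 \<Rightarrow>\<^sub>0 nat) + (2 \<Rightarrow>\<^sub>0 nat)) set" where "I = coeff_coords d"
  define S where "S = {x \<in> I \<rightarrow>\<^sub>E UNIV. R x = 0}"
  have inI: "Inl (bimonom d i) \<in> I" "Inr (bimonom d i) \<in> I" if "i \<le> d" for i
    using that by (auto simp: I_def coeff_coords_def monom_degree_bimonom)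
  have entry: "poly_fun I (\<lambda>x. sylvester d (\<lambda>i. x (Inl (bimonom d i))) (\<lambda>i. x (Inr (bimonom d i))) k j :: real)"
    for k j
    by (rule poly_fun_sylvester[where g = "\<lambda>x i. x (Inl (bimonom d i))" and h = "\<lambda>x i. x (Inr (bimonom d i))"])
      (rule poly_fun_var, erule inI)+
  have "poly_fun I R"
    unfolding R_def by (rule poly_fun_det) (rule entry)
  then obtain q where q: "mpoly_vars q \<subseteq> I" "\<And>x. mpoly_eval q x = R x"
    by (auto simp: poly_fun_def)
  have R_cong: "R x = R x'" if "\<And>i. i \<in> I \<Longrightarrow> x i = x' i" for x x'
  proof -
    have "mat (2*d) (2*d) (\<lambda>(k, j).
       sylvester d (\<lambda>i. x (Inl (bimonom d i))) (\<lambda>i. x (Inr (bimonom d i))) k j) =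
      mat (2*d) (2*d) (\<lambda>(k, j).
       sylvester d (\<lambda>i. x' (Inl (bimonom d i))) (\<lambda>i. x' (Inr (bimonom d i))) k j)"
      by (rule eq_matI) (auto simp: sylvester_def intro!: that inI)
    then show ?thesis
      by (simp add: R_def)
  qed
  have "real_algebraic_subset I S"
    unfolding real_algebraic_subset_def using q
    by (intro exI[of _ "{q}"]) (auto simp: S_def)
  moreover have "S \<noteq> I \<rightarrow>\<^sub>E UNIV"
  proof -
    \<comment> \<open>On exponent vectors of degree \<open>d\<close> these are the coefficients of
      \<open>z_1^d + \<i> z_2^d\<close>; \<open>R\<close> does not see the other
      coordinates.\<close>
    let ?x = "case_sum (\<lambda>m. if Poly_Mapping.lookup m 2 = 0 then 1 else 0)
      (\<lambda>m. if Poly_Mapping.lookup m 2 = d then 1 else 0) :: (2 \<Rightarrow>\<^sub>0 nat) + (2 \<Rightarrow>\<^sub>0 nat) \<Rightarrow> real"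
    have "R (restrict ?x I) = R ?x"
      by (rule R_cong) simp
    also have "\<dots> = 1"
      using det_sylvester_powers[of d] by (simp add: R_def lookup_bimonom)
    finally have "restrict ?x I \<notin> S"
      by (simp add: S_def)
    moreover have "restrict ?x I \<in> I \<rightarrow>\<^sub>E UNIV"
      by simp
    ultimately show ?thesis
      by metis
  qed
  moreover have "mpoly_eval (initial_form p) (\<lambda>i. of_real (x $ i)) \<noteq> 0"
    if p: "total_degree p = d" "coeff_vector d p \<notin> S" and x: "x \<noteq> 0"
    for p :: "(2, complex) mpoly" and x :: "real^2"
  proof
    assume "mpoly_eval (initial_form p) (\<lambda>i. of_real (x $ i)) = 0"
    then have *: "(\<Sum>i\<le>d. Poly_Mapping.lookup p (bimonom d i) *
        of_real (x $ 1) ^ (d - i) * of_real (x $ 2) ^ i) = 0"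
      by (simp only: mpoly_eval_initial_form_2[OF p(1)])
    have "coeff_vector d p \<in> I \<rightarrow>\<^sub>E UNIV"
      by (simp add: coeff_vector_def I_def)
    then have "R (coeff_vector d p) \<noteq> 0"
      using p(2) by (simp add: S_def)
    moreover have "R (coeff_vector d p) = R (case_sum (\<lambda>m. Re (Poly_Mapping.lookup p m)) (\<lambda>m. Im (Poly_Mapping.lookup p m)))"
      by (rule R_cong) (simp add: coeff_vector_def I_def)
    moreover have "R (case_sum (\<lambda>m. Re (Poly_Mapping.lookup p m)) (\<lambda>m. Im (Poly_Mapping.lookup p m))) = 0"
      unfolding R_def
    proof (rule det_sylvester_common_root[OF assms])
      show "x $ 1 \<noteq> 0 \<or> x $ 2 \<noteq> 0"
        using x by (auto simp: Finite_Cartesian_Product.vec_eq_iff forall_2)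
      \<comment> \<open>As \<open>x\<close> is real, taking real or imaginary parts of the sum acts
        on the coefficients alone.\<close>
      show "(\<Sum>i\<le>d. case_sum (\<lambda>m. Re (Poly_Mapping.lookup p m)) (\<lambda>m. Im (Poly_Mapping.lookup p m))
          (Inl (bimonom d i)) * (x $ 1) ^ (d - i) * (x $ 2) ^ i) = 0"
        using arg_cong[OF *, of Re] by (simp flip: of_real_power)
      show "(\<Sum>i\<le>d. case_sum (\<lambda>m. Re (Poly_Mapping.lookup p m)) (\<lambda>m. Im (Poly_Mapping.lookup p m))
          (Inr (bimonom d i)) * (x $ 1) ^ (d - i) * (x $ 2) ^ i) = 0"
        using arg_cong[OF *, of Im] by (simp flip: of_real_power)
    qed
    ultimately show False
      by simp
  qed
  ultimately show ?thesis
    unfolding holds_generically_def I_def by (intro exI[of _ S] conjI allI impI) simp_all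
qed

theorem theorem3p4:
  shows "(\<forall>(p :: (2, complex) mpoly) d.
            total_degree p = d \<and> proj_roots (initial_form p) \<inter> real_proj_space = {} \<and> odd d
            \<longrightarrow> imaginary_projection p = UNIV)
       \<and> (\<forall>d. odd d \<longrightarrow>
            holds_generically d (\<lambda>p :: (2, complex) mpoly. imaginary_projection p = UNIV))"
proof (intro conjI allI impI; (elim conjE)?)
  fix p :: "(2, complex) mpoly" and d
  assume "total_degree p = d" "proj_roots (initial_form p) \<inter> real_proj_space = {}" "odd d"
  then show "imaginary_projection p = UNIV"
    by (intro imaginary_projection_odd_degree initial_form_nonzero) auto
next
  fix d :: nat assume d: "odd d"
  obtain S where S: "real_algebraic_subset (coeff_coords d) S" "S \<noteq> coeff_coords d \<rightarrow>\<^sub>E UNIV"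
    and nz: "\<And>(p :: (2, complex) mpoly) x :: real^2. total_degree p = d \<Longrightarrow> coeff_vector d p \<notin> S \<Longrightarrow>
      x \<noteq> 0 \<Longrightarrow> mpoly_eval (initial_form p) (\<lambda>i. of_real (x $ i)) \<noteq> 0"
    using generic_initial_form_nonzero[OF odd_pos[OF d]] unfolding holds_generically_def by auto
  have "imaginary_projection p = UNIV" if "total_degree p = d" "coeff_vector d p \<notin> S"
    for p :: "(2, complex) mpoly"
    using that d nz[OF that] by (intro imaginary_projection_odd_degree) auto
  with S show "holds_generically d (\<lambda>p :: (2, complex) mpoly. imaginary_projection p = UNIV)"
    unfolding holds_generically_def by (intro exI[of _ S]) simp
qed

end
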